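(* Let $\mathcal{L}=(L,\wedge,\vee,0,1)$ be a complete lattice, $X\subseteq L\setminus\{1\}$ a non-empty subset, and $\emptyset\neq\mathcal{A}\subseteq X$. (1) Let $\mathcal{L}$ be $X$-top. If $I(\mathcal{A})$ is irreducible in $(\mathcal{C}(L),\wedge)$, then $\mathcal{A}$ is an irreducible subset of the topological space $X$. (2) Let $\mathcal{L}$ be strongly $X$-top. The following are equivalent: (a) $I(\mathcal{A})$ is irreducible in $(\mathcal{C}(L),\wedge)$; (b) $\mathcal{A}$ is an irreducible subset of $X$; (c) $I(\mathcal{A})$ is irreducible in $(L,\wedge)$; (c') $I(\mathcal{A})$ is strongly irreducible in $(L,\wedge)$.
   Context: For a complete lattice $\mathcal{L}=(L,\wedge,\vee,0,1)$ and a non-empty $X\subseteq L\setminus\{1\}$, let $\mathcal{P}(X)$ be the power set of $X$ and define $V:L\to\mathcal{P}(X)$, $V(a)=\{p\in X\mid a\le p\}$, and $I:\mathcal{P}(X)\to L$, $I(\mathcal{A})=\bigwedge\mathcal{A}$. Put $\mathcal{C}(L)=\{a\in L\mid a=I(V(a))\}=\{I(\mathcal{A})\mid\mathcal{A}\subseteq X\}$, which is closed under meets of $L$. An element $p$ of a lower semilattice $(S,\wedge)$ is irreducible if for all $a,b\in S$ with $p\le a$ and $p\le b$: $a\wedge b\le p$ implies $a\le p$ or $b\le p$. It is strongly irreducible if this implication holds for all $a,b\in S$. $\mathcal{L}$ is called $X$-top if $V(L)=\{V(a)\mid a\in L\}$ is closed under finite unions; in that case $X$ is regarded as a topological space whose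 closed sets are exactly the sets $V(a)$, $a\in L$. $\mathcal{L}$ is strongly $X$-top if every element of $X$ is strongly irreducible in $(L,\wedge)$; a strongly $X$-top lattice is $X$-top, so $X$ again carries this topology. A non-empty subset $\mathcal{A}$ of a topological space $\mathbf{X}$ is irreducible if for all proper closed subsets $A_1,A_2$ of $\mathbf{X}$: $\mathcal{A}\subseteq A_1\cup A_2$ implies $\mathcal{A}\subseteq A_1$ or $\mathcal{A}\subseteq A_2$. *)

theory Defs
  imports "HOL-Analysis.Abstract_Topology"
begin

text \<open>The complete lattice \<open>L\<close> is the type \<open>'a::complete_lattice\<close>, with \<open>1 = top\<close>;
  the subset \<open>X\<close> is an explicit parameter.\<close>

definition V_map :: "'a::complete_lattice set \<Rightarrow> 'a \<Rightarrow> 'a set"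
  where "V_map X a = {p \<in> X. a \<le> p}"

text \<open>The empty meet gives \<open>I_map {} = top\<close>.\<close>

definition I_map :: "'a::complete_lattice set \<Rightarrow> 'a"
  where "I_map A = Inf A"

definition C_set :: "'a::complete_lattice set \<Rightarrow> 'a set"
  where "C_set X = {a. a = I_map (V_map X a)}"

lemma C_set_eq_image: "C_set X = I_map ` Pow X"
proof
  show "C_set X \<subseteq> I_map ` Pow X"
    by (auto simp: C_set_def V_map_def)
  show "I_map ` Pow X \<subseteq> C_set X"
  proof
    fix a assume "a \<in> I_map ` Pow X"
    then obtain A where A: "A \<subseteq> X" "a = Inf A"
      by (auto simp: I_map_def)
    have "A \<subseteq> V_map X a"
      using A by (auto simp: V_map_def intro: Inf_lower)
    then have "Inf (V_map X a) \<le> a"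
      using A by (simp add: Inf_superset_mono)
    moreover have "a \<le> Inf (V_map X a)"
      by (rule Inf_greatest) (simp add: V_map_def)
    ultimately show "a \<in> C_set X"
      by (simp add: C_set_def I_map_def)
  qed
qed

lemma C_set_Inf_closed:
  assumes "B \<subseteq> C_set X" shows "Inf B \<in> C_set X"
proof -
  have "Inf (V_map X (Inf B)) \<le> b" if "b \<in> B" for b
  proof -
    have "V_map X b \<subseteq> V_map X (Inf B)"
      using that by (auto simp: V_map_def intro: Inf_lower2)
    then have "Inf (V_map X (Inf B)) \<le> Inf (V_map X b)"
      by (rule Inf_superset_mono)
    also have "\<dots> = b"
      using that assms by (auto simp: C_set_def I_map_def)
    finally show ?thesis .
  qed
  then have "Inf (V_map X (Inf B)) \<le> Inf B"
    by (rule Inf_greatest)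
  moreover have "Inf B \<le> Inf (V_map X (Inf B))"
    by (rule Inf_greatest) (simp add: V_map_def)
  ultimately show ?thesis
    by (simp add: C_set_def I_map_def)
qed

lemma C_set_inf_closed: "a \<in> C_set X \<Longrightarrow> b \<in> C_set X \<Longrightarrow> inf a b \<in> C_set X"
  using C_set_Inf_closed[of "{a, b}" X] by simp

text \<open>In the next two definitions the lower semilattice \<open>(S, \<and>)\<close> is a subset \<open>S\<close> closed under
  the ambient \<open>inf\<close>; this covers \<open>S = UNIV\<close> and \<open>S = C_set X\<close>.\<close>

definition irreducible_in :: "'a::semilattice_inf set \<Rightarrow> 'a \<Rightarrow> bool"
  where "irreducible_in S p \<longleftrightarrow> p \<in> S \<and>
    (\<forall>a\<in>S. \<forall>b\<in>S. p \<le> a \<longrightarrow> p \<le> b \<longrightarrow> inf a b \<le> p \<longrightarrow> a \<le> p \<or> b \<le> p)"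

definition strongly_irreducible_in :: "'a::semilattice_inf set \<Rightarrow> 'a \<Rightarrow> bool"
  where "strongly_irreducible_in S p \<longleftrightarrow> p \<in> S \<and>
    (\<forall>a\<in>S. \<forall>b\<in>S. inf a b \<le> p \<longrightarrow> a \<le> p \<or> b \<le> p)"

definition X_top :: "'a::complete_lattice set \<Rightarrow> bool"
  where "X_top X \<longleftrightarrow>
    (\<forall>F. finite F \<and> F \<subseteq> range (V_map X) \<longrightarrow> \<Union>F \<in> range (V_map X))"

definition strongly_X_top :: "'a::complete_lattice set \<Rightarrow> bool"
  where "strongly_X_top X \<longleftrightarrow> (\<forall>p\<in>X. strongly_irreducible_in UNIV p)"

text \<open>This is a meaningful topology only if \<open>X_top X\<close> holds; see \<open>closedin_V_topology\<close> below.\<close>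

definition V_topology :: "'a::complete_lattice set \<Rightarrow> 'a topology"
  where "V_topology X = topology (\<lambda>U. U \<subseteq> X \<and> X - U \<in> range (V_map X))"

definition irreducible_subset :: "'a topology \<Rightarrow> 'a set \<Rightarrow> bool"
  where "irreducible_subset T A \<longleftrightarrow> A \<noteq> {} \<and> A \<subseteq> topspace T \<and>
    (\<forall>A1 A2. closedin T A1 \<and> A1 \<noteq> topspace T \<and> closedin T A2 \<and> A2 \<noteq> topspace T \<longrightarrow>
       A \<subseteq> A1 \<union> A2 \<longrightarrow> A \<subseteq> A1 \<or> A \<subseteq> A2)"

lemma strongly_X_top_imp_X_top:
  assumes "top \<notin> X" "strongly_X_top X"
  shows "X_top X"
  unfolding X_top_def
proof (intro allI impI, elim conjE)
  fix F assume "finite F" "F \<subseteq> range (V_map X)"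
  then show "\<Union>F \<in> range (V_map X)"
  proof (induction F rule: finite_induct)
    case empty
    have "V_map X top = {}"
      using assms(1) by (auto simp: V_map_def top_unique)
    then show ?case by (metis Union_empty rangeI)
  next
    case (insert B F)
    then obtain a b where ab: "B = V_map X a" "\<Union>F = V_map X b" by auto
    have "V_map X a \<union> V_map X b = V_map X (inf a b)"
      using assms(2)
      by (auto simp: V_map_def strongly_X_top_def strongly_irreducible_in_def
               intro: le_infI1 le_infI2)
    then show ?case using ab by auto
  qed
qed

lemma istopology_V:
  assumes "X_top X"
  shows "istopology (\<lambda>U. U \<subseteq> X \<and> X - U \<in> range (V_map X))"
  unfolding istopology_def
proof (intro conjI allI impI)
  fix S T
  assume S: "S \<subseteq> X \<and> X - S \<in> range (V_map X)" and T: "T \<subseteq> X \<and> X - T \<in> range (V_map X)"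
  then show "S \<inter> T \<subseteq> X" by blast
  have "\<Union>{X - S, X - T} \<in> range (V_map X)"
    by (rule assms[unfolded X_top_def, rule_format]) (use S T in simp)
  then show "X - S \<inter> T \<in> range (V_map X)" by (simp add: Diff_Int)
next
  fix K assume K: "\<forall>U\<in>K. U \<subseteq> X \<and> X - U \<in> range (V_map X)"
  then show "\<Union>K \<subseteq> X" by blast
  from K have "\<forall>U\<in>K. \<exists>a. X - U = V_map X a" by blast
  then obtain f where f: "\<And>U. U \<in> K \<Longrightarrow> X - U = V_map X (f U)" by metis
  have "X - \<Union>K = V_map X (Sup (f ` K))"
  proof (intro equalityI subsetI)
    fix p assume "p \<in> X - \<Union>K"
    then have "p \<in> V_map X (f U)" if "U \<in> K" for U
      using that f[OF that] by auto
    with \<open>p \<in> X - \<Union>K\<close> show "p \<in> V_map X (Sup (f ` K))"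
      by (simp add: V_map_def Sup_le_iff)
  next
    fix p assume p: "p \<in> V_map X (Sup (f ` K))"
    then have "p \<in> V_map X (f U)" if "U \<in> K" for U
      using that by (simp add: V_map_def Sup_le_iff)
    then have "p \<notin> U" if "U \<in> K" for U
      using that f[OF that] by blast
    then show "p \<in> X - \<Union>K"
      using p by (auto simp: V_map_def)
  qed
  then show "X - \<Union>K \<in> range (V_map X)" by blast
qed

lemma openin_V_topology:
  "X_top X \<Longrightarrow> openin (V_topology X) U \<longleftrightarrow> U \<subseteq> X \<and> X - U \<in> range (V_map X)"
  unfolding V_topology_def by (subst topology_inverse'[OF istopology_V]) simp_all

lemma topspace_V_topology:
  assumes "X_top X" shows "topspace (V_topology X) = X"
proof -
  have "\<Union>{} \<in> range (V_map X)"
    using assms unfolding X_top_def by blast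
  then have "openin (V_topology X) X"
    using assms by (simp add: openin_V_topology)
  then show ?thesis
    using assms openin_V_topology[OF assms] by (meson openin_subset openin_topspace subset_antisym)
qed

lemma closedin_V_topology:
  assumes "X_top X"
  shows "closedin (V_topology X) B \<longleftrightarrow> B \<in> range (V_map X)"
proof -
  have "B \<subseteq> X" if "B \<in> range (V_map X)"
    using that by (auto simp: V_map_def)
  then show ?thesis
    unfolding closedin_def topspace_V_topology[OF assms] openin_V_topology[OF assms]
    by (metis Diff_subset double_diff subset_refl)
qed

end

theory Submission
  imports Defs
begin

text \<open>Both sides say that \<open>a\<close> is a lower bound of \<open>A\<close>: this is the
  antitone Galois connection between \<open>V_map X\<close> and \<open>I_map\<close>. It turns
  inclusions into closed sets into inequalities in the lattice and back.\<close>

lemma subset_V_map_iff: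
  assumes "A \<subseteq> X"
  shows "A \<subseteq> V_map X a \<longleftrightarrow> a \<le> I_map A"
  using assms by (auto simp: V_map_def I_map_def le_Inf_iff)

lemma I_map_in_C_set: "A \<subseteq> X \<Longrightarrow> I_map A \<in> C_set X"
  by (auto simp: C_set_eq_image)

lemma irreducible_subset_if_irreducible_in_C_set:
  assumes "X_top X" "A \<noteq> {}" "A \<subseteq> X" and irr: "irreducible_in (C_set X) (I_map A)"
  shows "irreducible_subset (V_topology X) A"
  unfolding irreducible_subset_def
proof (intro conjI allI impI; (elim conjE)?)
  fix A1 A2
  assume "closedin (V_topology X) A1" "closedin (V_topology X) A2" and cover: "A \<subseteq> A1 \<union> A2"
  then obtain a1 a2 where a: "A1 = V_map X a1" "A2 = V_map X a2"
    by (auto simp: closedin_V_topology[OF assms(1)])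
  \<comment> \<open>Irreducibility only concerns elements above \<open>I_map A\<close>, so \<open>a1\<close> and \<open>a2\<close> are replaced
    by the meets of the two parts of \<open>A\<close>.\<close>
  define b where "b = (\<lambda>B. I_map (A \<inter> B))"
  \<comment> \<open>If \<open>A\<close> misses \<open>B\<close>, then \<open>b B\<close> is the
    empty meet \<open>top\<close>, which still lies in \<open>C_set X\<close> as the image of the
    empty set. So no case split is needed.\<close>
  have inC: "b B \<in> C_set X" and above: "I_map A \<le> b B" for B
    using assms(3) by (auto simp: b_def I_map_def intro: I_map_in_C_set[unfolded I_map_def]
        Inf_superset_mono)
  have "inf (b A1) (b A2) = Inf (A \<inter> A1 \<union> A \<inter> A2)"
    by (simp add: b_def I_map_def Inf_union_distrib)
  also have "A \<inter> A1 \<union> A \<inter> A2 = A"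
    using cover by blast
  finally have "inf (b A1) (b A2) \<le> I_map A"
    by (simp add: I_map_def)
  then have "b A1 \<le> I_map A \<or> b A2 \<le> I_map A"
    using irr inC above unfolding irreducible_in_def by blast
  \<comment> \<open>Every element of \<open>A \<inter> A1\<close> lies above \<open>a1\<close>, so
    \<open>b A1 \<le> I_map A\<close> forces \<open>a1 \<le> I_map A\<close>, and likewise for
    \<open>a2\<close>.\<close>
  moreover have "a1 \<le> b A1" "a2 \<le> b A2"
    by (auto simp: a b_def I_map_def V_map_def intro: Inf_greatest)
  ultimately show "A \<subseteq> A1 \<or> A \<subseteq> A2"
    unfolding a subset_V_map_iff[OF assms(3)] by (meson order_trans)
qed (use assms in \<open>simp_all add: topspace_V_topology\<close>)

text \<open>Since each point of \<open>X\<close> is strongly irreducible, a meet below a point has a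
  factor below it. Hence \<open>inf a b \<le> I_map A\<close> makes \<open>V_map X a\<close> and
  \<open>V_map X b\<close> cover \<open>A\<close>, and one of them must contain
  \<open>A\<close>.\<close>

lemma strongly_irreducible_in_if_irreducible_subset:
  assumes "X_top X" "strongly_X_top X" "A \<subseteq> X" and irr: "irreducible_subset (V_topology X) A"
  shows "strongly_irreducible_in UNIV (I_map A)"
  unfolding strongly_irreducible_in_def
proof (intro conjI ballI impI)
  fix a b assume "inf a b \<le> I_map A"
  then have "A \<subseteq> V_map X (inf a b)"
    by (simp add: subset_V_map_iff[OF assms(3)])
  also have "V_map X (inf a b) \<subseteq> V_map X a \<union> V_map X b"
    using assms(2) by (auto simp: V_map_def strongly_X_top_def strongly_irreducible_in_def)
  finally have "A \<subseteq> V_map X a \<union> V_map X b" .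
  \<comment> \<open>Irreducibility of \<open>A\<close> only tests proper closed sets. If one of the
    two sets is all of \<open>X\<close>, it contains \<open>A\<close> because
    \<open>A \<subseteq> X\<close>.\<close>
  then have "A \<subseteq> V_map X a \<or> A \<subseteq> V_map X b"
    using irr assms(3)
    unfolding irreducible_subset_def closedin_V_topology[OF assms(1)] topspace_V_topology[OF assms(1)]
    by (metis rangeI)
  then show "a \<le> I_map A \<or> b \<le> I_map A"
    by (simp add: subset_V_map_iff[OF assms(3)])
qed simp

lemma irreducible_in_if_strongly_irreducible_in:
  "strongly_irreducible_in S p \<Longrightarrow> irreducible_in S p"
  unfolding irreducible_in_def strongly_irreducible_in_def by blast

text \<open>Both carriers use the ambient \<open>inf\<close>, so passing to \<open>T\<close> only
  leaves fewer pairs to test. With \<open>C_set X\<close> inside \<open>UNIV\<close> this yields (c)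
  => (a).\<close>

lemma irreducible_in_subset:
  "irreducible_in S p \<Longrightarrow> T \<subseteq> S \<Longrightarrow> p \<in> T \<Longrightarrow> irreducible_in T p"
  unfolding irreducible_in_def by blast

theorem proposition2p7:
  fixes X A :: "'a::complete_lattice set"
  assumes "X \<noteq> {}" and "X \<subseteq> UNIV - {top}"
    and "A \<noteq> {}" and "A \<subseteq> X"
  shows "(X_top X \<longrightarrow> irreducible_in (C_set X) (I_map A)
            \<longrightarrow> irreducible_subset (V_topology X) A) \<and>
         (strongly_X_top X \<longrightarrow>
            (irreducible_in (C_set X) (I_map A) \<longleftrightarrow> irreducible_subset (V_topology X) A) \<and>
            (irreducible_subset (V_topology X) A \<longleftrightarrow> irreducible_in UNIV (I_map A)) \<and>
            (irreducible_in UNIV (I_map A) \<longleftrightarrow> strongly_irreducible_in UNIV (I_map A)))"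
proof (intro conjI impI)
  assume "X_top X" "irreducible_in (C_set X) (I_map A)"
  then show "irreducible_subset (V_topology X) A"
    using assms(3,4) by (intro irreducible_subset_if_irreducible_in_C_set)
next
  assume strong: "strongly_X_top X"
  \<comment> \<open>The exclusion of \<open>top\<close> from \<open>X\<close> makes the empty union
    closed, as \<open>V_map X top\<close>.\<close>
  with assms(2) have top: "X_top X"
    by (intro strongly_X_top_imp_X_top) auto
  \<comment> \<open>The four facts close the cycle (a) => (b) => (c') => (c) => (a).\<close>
  note a_b = irreducible_subset_if_irreducible_in_C_set[OF top assms(3,4)]
  note b_c' = strongly_irreducible_in_if_irreducible_subset[OF top strong assms(4)]
  note c'_c = irreducible_in_if_strongly_irreducible_in[of UNIV "I_map A"]
  note c_a = irreducible_in_subset[OF _ subset_UNIV I_map_in_C_set[OF assms(4)]]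
  show "irreducible_in (C_set X) (I_map A) \<longleftrightarrow> irreducible_subset (V_topology X) A"
    "irreducible_subset (V_topology X) A \<longleftrightarrow> irreducible_in UNIV (I_map A)"
    "irreducible_in UNIV (I_map A) \<longleftrightarrow> strongly_irreducible_in UNIV (I_map A)"
    using a_b b_c' c'_c c_a by blast+
qed

end
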